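(* Let $m\ge2$, $\sigma>0$, and let $p_1,p_2,\dots$ be a sequence of monic real-rooted polynomials of degree $m$, $p_i(x)=\prod_{j=1}^m(x-r_{i,j})$, such that for all $i$ \[ \sum_j r_{i,j}=0\qquad\text{and}\qquad \frac1m\sum_j r_{i,j}^2=\sigma^2. \] For $n\ge1$ let $q_i(x)=n^{-m/2}p_i(\sqrt n\,x)$. Then \[ \lim_{n\to\infty}[\,q_1\boxplus_m\cdots\boxplus_m q_n\,]=\mathfrak{N}_m[0,\sigma^2] \] (coefficientwise).
   Context: For polynomials $p(x)=\sum_{i=0}^m x^{m-i}(-1)^i p_i$ and $q(x)=\sum_{i=0}^m x^{m-i}(-1)^i q_i$ of degree at most $m$, the symmetric additive convolution is \[ [p\boxplus_m q](x)=\sum_{i+j\le m} x^{m-i-j}(-1)^{i+j}\frac{(m-i)!\,(m-j)!}{(m-i-j)!\,m!}\,p_i q_j, \] which is associative. Let $H_m$ denote the monic (probabilists') Hermite polynomial of degree $m$, orthogonal with respect to the Gaussian weight $e^{-x^2/2}$: $H_m(x)=\sum_{k\le m/2}\frac{(-1)^k m!}{k!(m-2k)!2^k}x^{m-2k}$. For real $\mu$ and $\sigma>0$, \[ \mathfrak{N}_m[\mu,\sigma^2](x)=\Big(\frac{m-1}{\sigma^2}\Big)^{-m/2}H_m\Big((x-\mu)\sqrt{\tfrac{m-1}{\sigma^2}}\Big). \] *)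

theory Defs
  imports "HOL-Analysis.Analysis" "HOL-Computational_Algebra.Polynomial"
begin

text \<open>The numbers \<open>p\<^sub>i\<close> in \<open>p(x) = (\<Sum>i\<le>m. x^(m-i) (-1)^i p\<^sub>i)\<close>, for a polynomial of degree
  at most \<open>m\<close> (meaningful for \<open>i \<le> m\<close>).\<close>

definition signed_coeff :: "nat \<Rightarrow> real poly \<Rightarrow> nat \<Rightarrow> real" where
  "signed_coeff m p i = (-1) ^ i * coeff p (m - i)"

definition sym_add_conv :: "nat \<Rightarrow> real poly \<Rightarrow> real poly \<Rightarrow> real poly" where
  "sym_add_conv m p q =
     (\<Sum>i\<le>m. \<Sum>j\<le>m - i.
        monom ((-1) ^ (i + j) * (fact (m - i) * fact (m - j) / (fact (m - i - j) * fact m))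
               * signed_coeff m p i * signed_coeff m q j) (m - i - j))"

text \<open>The convolution of \<open>q 1, \<dots>, q n\<close> for \<open>n \<ge> 1\<close>, bracketed to the left; the
  convolution is associative, so the bracketing is immaterial. The value at \<open>n = 0\<close>
  is \<open>q 1\<close>, without significance.\<close>

definition iter_conv :: "nat \<Rightarrow> (nat \<Rightarrow> real poly) \<Rightarrow> nat \<Rightarrow> real poly" where
  "iter_conv m q n = foldl (sym_add_conv m) (q 1) (map q [2..<Suc n])"

text \<open>Probabilists' (monic) Hermite polynomials.\<close>

definition hermite_poly :: "nat \<Rightarrow> real poly" where
  "hermite_poly m =
     (\<Sum>k\<le>m div 2. monom ((-1) ^ k * fact m / (fact k * fact (m - 2 * k) * 2 ^ k)) (m - 2 * k))"

text \<open>The third argument is the variance \<open>\<sigma>\<^sup>2\<close>, not \<open>\<sigma>\<close>. The inner polynomial is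
  \<open>(x - \<mu>) * sqrt ((m - 1) / \<sigma>\<^sup>2)\<close>.\<close>

definition gaussian_poly :: "nat \<Rightarrow> real \<Rightarrow> real \<Rightarrow> real poly" where
  "gaussian_poly m \<mu> v =
     smult (((real m - 1) / v) powr (- (real m / 2)))
       (pcompose (hermite_poly m) (smult (sqrt ((real m - 1) / v)) [:- \<mu>, 1:]))"

text \<open>\<open>n^(-m/2) p(sqrt n x)\<close>\<close>

definition clt_rescale :: "nat \<Rightarrow> nat \<Rightarrow> real poly \<Rightarrow> real poly" where
  "clt_rescale m n p = smult (real n powr (- (real m / 2))) (pcompose p [:0, sqrt (real n):])"

end

theory Submission
  imports Defs "HOL-Computational_Algebra.Formal_Laurent_Series" "HOL-Real_Asymp.Real_Asymp"
begin

text \<open>Multiplying the \<open>i\<close>-th signed coefficient by \<open>(m - i)! / m!\<close> turns the convolution into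
  multiplication of power series modulo \<open>X^(m + 1)\<close>. The images of the \<open>p\<^sub>i\<close> have the form
  \<open>1 + c X\<^sup>2 + O(X\<^sup>3)\<close> with \<open>c = - \<sigma>\<^sup>2 / (2 (m - 1))\<close> and uniformly bounded coefficients, and rescaling
  substitutes \<open>X / sqrt n\<close> for \<open>X\<close>. As in the classical central limit theorem, the product of the
  \<open>n\<close> factors is compared with \<open>exp (c X\<^sup>2 / n) ^ n = exp (c X\<^sup>2)\<close>, which is the image of the Hermite
  polynomial; each factor contributes an error \<open>O(n powr (-3/2))\<close>.\<close>

unbundle no vec_syntax and fps_syntax

section \<open>A central limit theorem for power series\<close>

text \<open>The l1 norm on power series modulo \<open>X ^ (K + 1)\<close>. It is submultiplicative,
  and limits are needed only one coefficient at a time.\<close>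

definition fps_trunc_norm :: "nat \<Rightarrow> real fps \<Rightarrow> real" where
  "fps_trunc_norm K f = (\<Sum>k\<le>K. \<bar>f $ k\<bar>)"

lemma fps_trunc_norm_nonneg [simp]: "fps_trunc_norm K f \<ge> 0"
  by (simp add: fps_trunc_norm_def sum_nonneg)

lemma abs_nth_le_fps_trunc_norm: "k \<le> K \<Longrightarrow> \<bar>f $ k\<bar> \<le> fps_trunc_norm K f"
  unfolding fps_trunc_norm_def by (rule member_le_sum) auto

lemma fps_trunc_norm_one [simp]: "fps_trunc_norm K 1 = 1"
  by (simp add: fps_trunc_norm_def if_distrib cong: if_cong)

lemma fps_trunc_norm_add: "fps_trunc_norm K (f + g) \<le> fps_trunc_norm K f + fps_trunc_norm K g"
  unfolding fps_trunc_norm_def sum.distrib [symmetric] by (intro sum_mono) auto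

text \<open>The pairs with \<open>i + j \<le> K\<close> lie in the square of pairs with both indices
  at most \<open>K\<close>, over which the sum factors.\<close>

lemma fps_trunc_norm_mult: "fps_trunc_norm K (f * g) \<le> fps_trunc_norm K f * fps_trunc_norm K g"
proof -
  have "fps_trunc_norm K (f * g) \<le> (\<Sum>k\<le>K. \<Sum>i\<le>k. \<bar>f $ i\<bar> * \<bar>g $ (k - i)\<bar>)"
    unfolding fps_trunc_norm_def fps_mult_nth abs_mult [symmetric] atMost_atLeast0
    by (intro sum_mono sum_abs)
  also have "\<dots> = (\<Sum>(i, j) | i + j \<le> K. \<bar>f $ i\<bar> * \<bar>g $ j\<bar>)"
    by (rule sum.triangle_reindex_eq [symmetric])
  also have "\<dots> \<le> (\<Sum>(i, j) \<in> {..K} \<times> {..K}. \<bar>f $ i\<bar> * \<bar>g $ j\<bar>)"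
    by (rule sum_mono2) auto
  also have "\<dots> = fps_trunc_norm K f * fps_trunc_norm K g"
    by (simp add: fps_trunc_norm_def sum_product sum.cartesian_product)
  finally show ?thesis .
qed

lemma fps_trunc_norm_prod_le:
  assumes "\<And>i. i \<in> I \<Longrightarrow> fps_trunc_norm K (f i) \<le> M"
  shows "fps_trunc_norm K (\<Prod>i\<in>I. f i) \<le> M ^ card I"
proof (cases "finite I")
  case True
  then show ?thesis using assms
  proof (induction I)
    case (insert x I)
    have "fps_trunc_norm K (f x * prod f I) \<le> fps_trunc_norm K (f x) * fps_trunc_norm K (prod f I)"
      by (rule fps_trunc_norm_mult)
    also have "\<dots> \<le> M * M ^ card I"
      using insert order_trans [OF fps_trunc_norm_nonneg insert.prems [of x]]
      by (intro mult_mono) auto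
    finally show ?case using insert by simp
  qed auto
qed auto

text \<open>Telescoping: replacing one factor costs at most \<open>D\<close> times a bound for the
  others, and \<open>M \<ge> 1\<close> lets the power be rounded up to
  \<open>card I\<close>.\<close>

lemma fps_trunc_norm_prod_diff_le:
  assumes "finite I" and "M \<ge> 1"
    and "\<And>i. i \<in> I \<Longrightarrow> fps_trunc_norm K (f i) \<le> M"
    and "\<And>i. i \<in> I \<Longrightarrow> fps_trunc_norm K (g i) \<le> M"
    and "\<And>i. i \<in> I \<Longrightarrow> fps_trunc_norm K (f i - g i) \<le> D"
  shows "fps_trunc_norm K ((\<Prod>i\<in>I. f i) - (\<Prod>i\<in>I. g i)) \<le> real (card I) * D * M ^ card I"
  using assms(1,3-5)
proof (induction I)
  case empty
  then show ?case by (simp add: fps_trunc_norm_def)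
next
  case (insert x I)
  have D: "D \<ge> 0"
    using order_trans [OF fps_trunc_norm_nonneg insert.prems(3) [of x]] by simp
  have "fps_trunc_norm K (f x * prod f I - g x * prod g I)
      = fps_trunc_norm K ((f x - g x) * prod f I + g x * (prod f I - prod g I))"
    by (simp add: algebra_simps)
  also have "\<dots> \<le> fps_trunc_norm K (f x - g x) * fps_trunc_norm K (prod f I)
      + fps_trunc_norm K (g x) * fps_trunc_norm K (prod f I - prod g I)"
    by (intro order_trans [OF fps_trunc_norm_add] add_mono fps_trunc_norm_mult)
  also have "\<dots> \<le> D * M ^ card I + M * (real (card I) * D * M ^ card I)"
    using insert D \<open>M \<ge> 1\<close> by (intro add_mono mult_mono fps_trunc_norm_prod_le) auto
  also have "\<dots> \<le> D * M ^ Suc (card I) + M * (real (card I) * D * M ^ card I)"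
    using D \<open>M \<ge> 1\<close> by (intro add_mono mult_left_mono power_increasing) auto
  also have "\<dots> = real (Suc (card I)) * D * M ^ Suc (card I)"
    by (simp add: algebra_simps)
  finally show ?case using insert by simp
qed

section \<open>Dilations and the Gaussian series\<close>

definition fps_dilate :: "real \<Rightarrow> real fps \<Rightarrow> real fps" where
  "fps_dilate e f = Abs_fps (\<lambda>k. e ^ k * f $ k)"

lemma fps_dilate_nth [simp]: "fps_dilate e f $ k = e ^ k * f $ k"
  by (simp add: fps_dilate_def)

text \<open>Only orders \<open>k \<ge> d\<close> contribute, where \<open>e ^ k \<le> e ^ d\<close>;
  there are at most \<open>K + 1\<close> such terms.\<close>

lemma fps_trunc_norm_dilate_le:
  assumes "0 \<le> e" "e \<le> 1" and "\<And>k. k < d \<Longrightarrow> f $ k = 0"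
    and "\<And>k. k \<le> K \<Longrightarrow> \<bar>f $ k\<bar> \<le> C"
  shows "fps_trunc_norm K (fps_dilate e f) \<le> real (Suc K) * C * e ^ d"
proof -
  have C: "C \<ge> 0" using assms(4) [of 0] by linarith
  have "\<bar>e ^ k * f $ k\<bar> \<le> e ^ d * C" if "k \<le> K" for k
  proof (cases "k < d")
    case False
    with that show ?thesis using assms
      by (auto simp: abs_mult intro!: mult_mono power_decreasing)
  qed (use assms C in auto)
  then have "fps_trunc_norm K (fps_dilate e f) \<le> (\<Sum>k\<le>K. e ^ d * C)"
    unfolding fps_trunc_norm_def fps_dilate_nth by (intro sum_mono) auto
  then show ?thesis by (simp add: algebra_simps)
qed

text \<open>Each factor is \<open>1 + O(e^2)\<close> because its linear coefficient vanishes, and it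
  agrees with the dilated \<open>b\<close> up to order 2, so the two differ by
  \<open>O(e^3)\<close>. These estimates serve as \<open>M\<close> and \<open>D\<close> in the
  telescoping bound.\<close>

lemma fps_trunc_norm_dilate_prod_diff_le:
  assumes "0 \<le> e" "e \<le> 1" "finite I"
    and a: "\<And>i. i \<in> I \<Longrightarrow> a i $ 0 = 1" "\<And>i. i \<in> I \<Longrightarrow> a i $ 1 = 0"
    and b: "b $ 0 = 1" "b $ 1 = 0" "\<And>i. i \<in> I \<Longrightarrow> a i $ 2 = b $ 2"
    and C: "\<And>i k. i \<in> I \<Longrightarrow> k \<le> K \<Longrightarrow> \<bar>a i $ k\<bar> \<le> C" "\<And>k. k \<le> K \<Longrightarrow> \<bar>b $ k\<bar> \<le> C"
  shows "fps_trunc_norm K ((\<Prod>i\<in>I. fps_dilate e (a i)) - fps_dilate e b ^ card I)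
    \<le> real (card I) * (real (Suc K) * (2 * C) * e ^ 3) * (1 + real (Suc K) * C * e ^ 2) ^ card I"
proof -
  have C0: "C \<ge> 0" using C(2) [of 0] by linarith
  have M: "fps_trunc_norm K (fps_dilate e f) \<le> 1 + real (Suc K) * C * e ^ 2"
    if "f $ 0 = 1" "f $ 1 = 0" "\<And>k. k \<le> K \<Longrightarrow> \<bar>f $ k\<bar> \<le> C" for f
  proof -
    \<comment> \<open>Without its constant term the series starts at order 2, so the dilation bound
      applies with \<open>d = 2\<close>.\<close>
    have split: "fps_dilate e f = 1 + fps_dilate e (f - 1)"
      by (rule fps_ext) (use that in \<open>auto simp: algebra_simps\<close>)
    have "(f - 1) $ k = 0" if "k < 2" for k
      using that \<open>f $ 0 = 1\<close> \<open>f $ 1 = 0\<close> by (cases k) auto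
    moreover have "\<bar>(f - 1) $ k\<bar> \<le> C" if "k \<le> K" for k
      using \<open>\<And>k. k \<le> K \<Longrightarrow> \<bar>f $ k\<bar> \<le> C\<close> [OF that] \<open>f $ 0 = 1\<close> C0 by (cases k) auto
    ultimately have "fps_trunc_norm K (fps_dilate e (f - 1)) \<le> real (Suc K) * C * e ^ 2"
      by (intro fps_trunc_norm_dilate_le assms) auto
    then show ?thesis
      unfolding split using fps_trunc_norm_add [of K 1 "fps_dilate e (f - 1)"] by simp
  qed
  have D: "fps_trunc_norm K (fps_dilate e (a i) - fps_dilate e b) \<le> real (Suc K) * (2 * C) * e ^ 3"
    if i: "i \<in> I" for i
  proof -
    have "fps_dilate e (a i) - fps_dilate e b = fps_dilate e (a i - b)"
      by (rule fps_ext) (simp add: algebra_simps)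
    moreover have "(a i - b) $ k = 0" if "k < 3" for k
    proof -
      from that have "k = 0 \<or> k = 1 \<or> k = 2" by auto
      then show ?thesis using a [OF i] b(1,2) b(3) [OF i] by auto
    qed
    moreover have "\<bar>(a i - b) $ k\<bar> \<le> 2 * C" if "k \<le> K" for k
      using C(1) [OF i that] C(2) [OF that] by simp
    ultimately show ?thesis
      using fps_trunc_norm_dilate_le [of e 3 "a i - b" K "2 * C"] assms(1,2) by simp
  qed
  have "fps_trunc_norm K ((\<Prod>i\<in>I. fps_dilate e (a i)) - (\<Prod>i\<in>I. fps_dilate e b))
    \<le> real (card I) * (real (Suc K) * (2 * C) * e ^ 3) * (1 + real (Suc K) * C * e ^ 2) ^ card I"
    using C0 a b C by (intro fps_trunc_norm_prod_diff_le M D assms(3)) auto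
  then show ?thesis by simp
qed

definition fps_gaussian :: "real \<Rightarrow> real fps" where
  "fps_gaussian c = fps_exp c oo fps_X ^ 2"

lemma fps_gaussian_nth:
  "fps_gaussian c $ k = (if even k then c ^ (k div 2) / fact (k div 2) else 0)"
  by (simp add: fps_gaussian_def fps_nth_compose_X_power)

text \<open>Stability of the Gaussian: the dilation turns \<open>exp (c X^2)\<close> into
  \<open>exp (c X^2 / n)\<close>, whose \<open>n\<close>-th power is the original series.\<close>

lemma fps_gaussian_dilate_power:
  assumes "n > 0"
  shows "fps_dilate (1 / sqrt (real n)) (fps_gaussian c) ^ n = fps_gaussian c"
proof -
  have "fps_dilate (1 / sqrt (real n)) (fps_gaussian c) = fps_gaussian (c / real n)"
    by (rule fps_ext)
       (auto simp: fps_gaussian_nth power_divide power_mult elim!: evenE)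
  also have "\<dots> ^ n = fps_gaussian c"
    using assms unfolding fps_gaussian_def
    by (simp add: fps_compose_power fps_exp_power_mult)
  finally show ?thesis .
qed

text \<open>With \<open>e = 1 / sqrt n\<close>, the \<open>n\<close> errors of order
  \<open>e^3\<close> add up to order \<open>e\<close>, while the bound
  \<open>(1 + A / n) ^ n\<close> on the products stays below \<open>exp A\<close>.\<close>

theorem fps_central_limit:
  assumes "\<And>i. i \<ge> 1 \<Longrightarrow> a i $ 0 = 1" "\<And>i. i \<ge> 1 \<Longrightarrow> a i $ 1 = 0" "\<And>i. i \<ge> 1 \<Longrightarrow> a i $ 2 = c"
    and "\<And>i k. i \<ge> 1 \<Longrightarrow> \<bar>a i $ k\<bar> \<le> C"
  shows "(\<lambda>n. (\<Prod>i=1..n. fps_dilate (1 / sqrt (real n)) (a i)) $ K) \<longlonglongrightarrow> fps_gaussian c $ K"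
proof -
  \<comment> \<open>\<open>B\<close> also bounds the coefficients of the limit up to index
    \<open>K\<close>, which \<open>C\<close> alone need not do.\<close>
  define B where "B = max C (fps_trunc_norm K (fps_gaussian c))"
  define A where "A = real (Suc K) * B"
  have A: "A \<ge> 0"
    by (auto simp: A_def B_def le_max_iff_disj)
  have bound: "\<bar>(\<Prod>i=1..n. fps_dilate (1 / sqrt (real n)) (a i)) $ K - fps_gaussian c $ K\<bar>
      \<le> 2 * A * exp A * (1 / sqrt (real n))" if "n \<ge> 1" for n
  proof -
    define e where "e = 1 / sqrt (real n)"
    have e: "0 \<le> e" "e \<le> 1" and ne: "real n * e ^ 2 = 1"
      using that by (auto simp: e_def power_divide)
    have g: "\<bar>fps_gaussian c $ k\<bar> \<le> B" if "k \<le> K" for k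
      using abs_nth_le_fps_trunc_norm [OF that, of "fps_gaussian c"] by (simp add: B_def)
    have "\<bar>(\<Prod>i=1..n. fps_dilate e (a i)) $ K - fps_gaussian c $ K\<bar>
        \<le> fps_trunc_norm K ((\<Prod>i=1..n. fps_dilate e (a i)) - fps_gaussian c)"
      using abs_nth_le_fps_trunc_norm [OF order_refl] by (metis fps_sub_nth)
    \<comment> \<open>The limit is written as a product of \<open>n\<close> equal dilated factors,
      so that the two products can be compared factor by factor.\<close>
    also have "\<dots> = fps_trunc_norm K
        ((\<Prod>i=1..n. fps_dilate e (a i)) - fps_dilate e (fps_gaussian c) ^ card {1..n})"
      using fps_gaussian_dilate_power [of n c] that by (simp add: e_def)
    also have "\<dots> \<le> real (card {1..n}) * (real (Suc K) * (2 * B) * e ^ 3)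
        * (1 + real (Suc K) * B * e ^ 2) ^ card {1..n}"
      using assms g e
      by (intro fps_trunc_norm_dilate_prod_diff_le)
         (auto simp: fps_gaussian_nth B_def le_max_iff_disj)
    also have "\<dots> = (real n * e ^ 2) * (2 * A * e) * (1 + A * e ^ 2) ^ n"
      by (simp add: A_def power2_eq_square power3_eq_cube)
    also have "\<dots> = 2 * A * e * (1 + A * e ^ 2) ^ n"
      by (simp add: ne)
    also have "\<dots> \<le> 2 * A * e * exp A"
    proof (rule mult_left_mono)
      have "(1 + A * e ^ 2) ^ n \<le> exp (A * e ^ 2) ^ n"
        using A by (intro power_mono exp_ge_add_one_self) auto
      also have "\<dots> = exp (A * (real n * e ^ 2))"
        by (simp add: exp_of_nat_mult [symmetric] mult_ac)
      finally show "(1 + A * e ^ 2) ^ n \<le> exp A" by (simp add: ne)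
    qed (use A e in auto)
    finally show ?thesis by (simp add: e_def mult_ac)
  qed
  have "(\<lambda>n. 2 * A * exp A * (1 / sqrt (real n))) \<longlonglongrightarrow> 0"
    by real_asymp
  then have "(\<lambda>n. (\<Prod>i=1..n. fps_dilate (1 / sqrt (real n)) (a i)) $ K - fps_gaussian c $ K) \<longlonglongrightarrow> 0"
    by (rule Lim_null_comparison [rotated])
       (use bound in \<open>auto intro!: eventually_sequentiallyI [of 1]\<close>)
  then show ?thesis by (rule LIM_zero_cancel)
qed

section \<open>The convolution as multiplication of power series\<close>

text \<open>For \<open>p\<close> of degree at most \<open>m\<close> this is the symbol
  \<open>F\<close> with \<open>p = F(- d/dx) x^m\<close>. The cut-off is explicit because
  \<open>m - i\<close> would be \<open>0\<close> for all \<open>i > m\<close>.\<close>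

definition conv_fps :: "nat \<Rightarrow> real poly \<Rightarrow> real fps" where
  "conv_fps m p = Abs_fps (\<lambda>i. if i \<le> m then fact (m - i) / fact m * signed_coeff m p i else 0)"

lemma conv_fps_nth:
  "conv_fps m p $ i = (if i \<le> m then fact (m - i) / fact m * signed_coeff m p i else 0)"
  by (simp add: conv_fps_def)

lemma coeff_conv_conv_fps:
  "i \<le> m \<Longrightarrow> coeff p (m - i) = (-1) ^ i * (fact m / fact (m - i)) * conv_fps m p $ i"
  by (simp add: conv_fps_nth signed_coeff_def flip: power_mult_distrib)

lemma degree_sym_add_conv_le: "degree (sym_add_conv m p q) \<le> m"
  unfolding sym_add_conv_def
  by (intro degree_sum_le) (auto intro!: order_trans [OF degree_monom_le])

text \<open>For \<open>i + j = k\<close> the weight \<open>(m - k)! / m!\<close> cancels the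
  \<open>(m - i - j)!\<close> of the convolution and leaves the weights of \<open>p\<close> and
  \<open>q\<close>. The product of the series may have coefficients beyond \<open>m\<close>, hence
  \<open>k \<le> m\<close>.\<close>

lemma conv_fps_sym_add_conv:
  assumes "k \<le> m"
  shows "conv_fps m (sym_add_conv m p q) $ k = (conv_fps m p * conv_fps m q) $ k"
proof -
  define w where "w i j = (-1) ^ (i + j) * (fact (m - i) * fact (m - j) / (fact (m - i - j) * fact m))
      * signed_coeff m p i * signed_coeff m q j" for i j :: nat
  \<comment> \<open>A monomial has degree \<open>m - k\<close> exactly when
    \<open>i + j = k\<close>; \<open>i \<le> k\<close> is stated because \<open>k - i\<close> is
    truncated.\<close>
  have "coeff (sym_add_conv m p q) (m - k)
      = (\<Sum>i\<le>m. \<Sum>j\<le>m - i. if j = k - i \<and> i \<le> k then w i j else 0)"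
    unfolding sym_add_conv_def coeff_sum w_def
    using assms by (intro sum.cong refl) auto
  also have "\<dots> = (\<Sum>i\<le>m. if i \<le> k then w i (k - i) else 0)"
    using assms by (intro sum.cong refl) (auto simp: sum.delta)
  also have "\<dots> = (\<Sum>i\<le>k. w i (k - i))"
    using assms by (intro sum.mono_neutral_cong_right) auto
  finally have coeff: "coeff (sym_add_conv m p q) (m - k) = (\<Sum>i\<le>k. w i (k - i))" .
  have "conv_fps m (sym_add_conv m p q) $ k
      = (\<Sum>i\<le>k. fact (m - k) / fact m * ((-1) ^ k * w i (k - i)))"
    using assms by (simp add: conv_fps_nth signed_coeff_def coeff sum_distrib_left)
  also have "\<dots> = (\<Sum>i\<le>k. conv_fps m p $ i * conv_fps m q $ (k - i))"
    using assms by (intro sum.cong refl) (simp add: conv_fps_nth w_def flip: power_mult_distrib)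
  finally show ?thesis by (simp add: fps_mult_nth atMost_atLeast0)
qed

lemma iter_conv_Suc: "n \<ge> 1 \<Longrightarrow> iter_conv m q (Suc n) = sym_add_conv m (iter_conv m q n) (q (Suc n))"
  by (simp add: iter_conv_def)

lemma degree_iter_conv_le:
  assumes "degree (q 1) \<le> m" "n \<ge> 1"
  shows "degree (iter_conv m q n) \<le> m"
  using assms(2)
proof (induction n rule: dec_induct)
  case base
  then show ?case using assms by (simp add: iter_conv_def)
qed (simp add: iter_conv_Suc degree_sym_add_conv_le)

text \<open>A coefficient of a product depends only on coefficients of at most the same index, so
  agreement up to \<open>m\<close> survives each further factor.\<close>

lemma conv_fps_iter_conv:
  assumes "n \<ge> 1" "k \<le> m"
  shows "conv_fps m (iter_conv m q n) $ k = (\<Prod>i=1..n. conv_fps m (q i)) $ k"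
  using assms
proof (induction n arbitrary: k rule: dec_induct)
  case base
  then show ?case by (simp add: iter_conv_def)
next
  case (step n)
  then have "conv_fps m (iter_conv m q (Suc n)) $ k
      = (\<Sum>i=0..k. conv_fps m (iter_conv m q n) $ i * conv_fps m (q (Suc n)) $ (k - i))"
    by (simp add: iter_conv_Suc conv_fps_sym_add_conv fps_mult_nth)
  also have "\<dots> = (\<Sum>i=0..k. (\<Prod>i=1..n. conv_fps m (q i)) $ i * conv_fps m (q (Suc n)) $ (k - i))"
    using step by (intro sum.cong refl) simp
  finally show ?case by (simp add: fps_mult_nth)
qed

section \<open>Rescaling of polynomials\<close>

lemma degree_pcompose_linear_le: "degree (pcompose p [:a, b:]) \<le> degree p"
proof -
  have "degree p * degree [:a, b:] \<le> degree p * 1"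
    by (intro mult_left_mono) auto
  then show ?thesis
    using degree_pcompose_le [of p "[:a, b:]"] by linarith
qed

text \<open>The prefactor cancels \<open>m\<close> powers of \<open>sqrt x\<close>, of which the
  substitution supplies \<open>m - i\<close>. Allowing real \<open>x\<close> covers both
  \<open>clt_rescale\<close> and \<open>gaussian_poly\<close>.\<close>

lemma coeff_rescale:
  fixes x :: real
  assumes "x > 0" "i \<le> m"
  shows "coeff (smult (x powr (- (real m / 2))) (pcompose p [:0, sqrt x:])) (m - i)
    = coeff p (m - i) / sqrt x ^ i"
proof -
  have "x powr (real m / 2) = sqrt x ^ i * sqrt x ^ (m - i)"
    using assms
    by (simp add: powr_half_sqrt [symmetric] powr_powr powr_realpow [symmetric] powr_add [symmetric]
        of_nat_diff field_simps)
  then show ?thesis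
    using assms by (simp add: coeff_pcompose_linear powr_minus field_simps)
qed

lemma conv_fps_clt_rescale:
  assumes "n \<ge> 1"
  shows "conv_fps m (clt_rescale m n p) = fps_dilate (1 / sqrt (real n)) (conv_fps m p)"
proof (rule fps_ext)
  fix i
  have "coeff (clt_rescale m n p) (m - i) = coeff p (m - i) / sqrt (real n) ^ i" if "i \<le> m"
    unfolding clt_rescale_def using assms that by (intro coeff_rescale) auto
  then show "conv_fps m (clt_rescale m n p) $ i = fps_dilate (1 / sqrt (real n)) (conv_fps m p) $ i"
    by (simp add: conv_fps_nth signed_coeff_def power_divide)
qed

section \<open>The Hermite polynomial\<close>

lemma coeff_hermite_poly:
  assumes "i \<le> m"
  shows "coeff (hermite_poly m) (m - i) =
    (if even i then (-1) ^ (i div 2) * fact m / (fact (i div 2) * fact (m - i) * 2 ^ (i div 2)) else 0)"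
proof -
  have "coeff (hermite_poly m) (m - i) = (\<Sum>k\<le>m div 2. if k = i div 2 \<and> even i
      then (-1) ^ k * fact m / (fact k * fact (m - 2 * k) * 2 ^ k) else 0)"
    unfolding hermite_poly_def coeff_sum coeff_monom
  proof (intro sum.cong refl if_cong)
    fix k assume "k \<in> {..m div 2}"
    then have "2 * k \<le> m" by auto
    \<comment> \<open>Both \<open>i\<close> and \<open>2 * k\<close> are at most \<open>m\<close>,
      so subtraction from \<open>m\<close> is injective on them.\<close>
    then have "m - 2 * k = m - i \<longleftrightarrow> i = 2 * k"
      using assms by linarith
    then show "m - 2 * k = m - i \<longleftrightarrow> k = i div 2 \<and> even i"
      by auto
  qed
  also have "\<dots> = (if even i
      then (-1) ^ (i div 2) * fact m / (fact (i div 2) * fact (m - i) * 2 ^ (i div 2)) else 0)"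
    using assms by (cases "even i") (auto simp: sum.delta div_le_mono)
  finally show ?thesis .
qed

lemma degree_gaussian_poly_le: "degree (gaussian_poly m \<mu> v) \<le> m"
proof -
  have "degree (hermite_poly m) \<le> m"
    unfolding hermite_poly_def by (intro degree_sum_le) (auto intro!: order_trans [OF degree_monom_le])
  then show ?thesis
    unfolding gaussian_poly_def
    by (auto intro!: order_trans [OF degree_smult_le] order_trans [OF degree_pcompose_linear_le])
qed

text \<open>The weight \<open>(m - k)! / m!\<close> cancels these factorials in the Hermite
  coefficient with \<open>k = 2 b\<close> and leaves \<open>(-1)^b / (b! 2^b)\<close>, as in
  \<open>exp (- X^2 / 2)\<close>. Rescaling then divides \<open>X^2\<close> by
  \<open>(m - 1) / v\<close>.\<close>

lemma conv_fps_gaussian_poly: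
  assumes "m \<ge> 2" "v > 0" "k \<le> m"
  shows "conv_fps m (gaussian_poly m 0 v) $ k = fps_gaussian (- v / (2 * (real m - 1))) $ k"
proof -
  define x where "x = (real m - 1) / v"
  have x: "x > 0" using assms by (simp add: x_def)
  have c: "- v / (2 * (real m - 1)) = - 1 / (2 * x)"
    using assms by (simp add: x_def field_simps)
  have "coeff (gaussian_poly m 0 v) (m - k) = coeff (hermite_poly m) (m - k) / sqrt x ^ k"
    using coeff_rescale [OF x assms(3), of "hermite_poly m"]
    by (simp add: gaussian_poly_def x_def)
  then have eq: "conv_fps m (gaussian_poly m 0 v) $ k
      = fact (m - k) / fact m * ((-1) ^ k * (coeff (hermite_poly m) (m - k) / sqrt x ^ k))"
    using assms by (simp add: conv_fps_nth signed_coeff_def)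
  show ?thesis
  proof (cases "even k")
    case True
    then obtain b where k: "k = 2 * b" by (elim evenE)
    have "sqrt x ^ k = x ^ b"
      using x by (simp add: k power_mult)
    moreover have "(- 1 / (2 * x)) ^ b = (-1) ^ b / (2 ^ b * x ^ b)"
      by (simp only: power_divide power_mult_distrib)
    ultimately show ?thesis
      unfolding eq coeff_hermite_poly [OF assms(3)] fps_gaussian_nth c
      using x by (simp add: k)
  next
    case False
    then show ?thesis
      by (simp add: eq coeff_hermite_poly [OF assms(3)] fps_gaussian_nth)
  qed
qed

section \<open>Monic polynomials with given roots\<close>

lemma degree_prod_linear: "finite J \<Longrightarrow> degree (\<Prod>j\<in>J. [:- r j, 1:]) = card J"
  for r :: "'b \<Rightarrow> 'a::idom"
  by (simp add: degree_prod_eq_sum_degree)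

text \<open>Up to sign the coefficients are elementary symmetric functions of the roots, which are
  dominated by terms in the expansion of the right side.\<close>

lemma abs_coeff_prod_linear_le:
  fixes r :: "'b \<Rightarrow> real"
  shows "\<bar>coeff (\<Prod>j\<in>J. [:- r j, 1:]) k\<bar> \<le> (\<Prod>j\<in>J. 1 + \<bar>r j\<bar>)"
proof (induction J arbitrary: k rule: infinite_finite_induct)
  case (insert x J)
  define P where "P = (\<Prod>j\<in>J. [:- r j, 1:])"
  define B where "B = (\<Prod>j\<in>J. 1 + \<bar>r j\<bar>)"
  have IH: "\<bar>coeff P k\<bar> \<le> B" for k
    using insert.IH by (simp add: P_def B_def)
  have B: "B \<ge> 0" using order_trans [OF abs_ge_zero IH] .
  have 1: "\<bar>r x * coeff P k\<bar> \<le> \<bar>r x\<bar> * B" for k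
    unfolding abs_mult by (intro mult_left_mono IH) auto
  have "\<bar>coeff ([:- r x, 1:] * P) k\<bar> \<le> B + \<bar>r x\<bar> * B"
  proof (cases k)
    case 0
    then show ?thesis using 1 [of 0] B by simp
  next
    case (Suc l)
    then show ?thesis using 1 [of k] IH [of l] by simp
  qed
  then show ?case using insert by (simp add: P_def B_def algebra_simps)
qed (auto simp: coeff_1)

text \<open>The last part is Newton's identity for the second elementary symmetric function. With
  reversed factors the indices 0, 1, 2 stay fixed in the induction; counted from the top degree they
  would move.\<close>

lemma coeff_prod_reflected_linear:
  fixes r :: "'b \<Rightarrow> real"
  assumes "finite J"
  shows "coeff (\<Prod>j\<in>J. [:1, - r j:]) 0 = 1"
    and "coeff (\<Prod>j\<in>J. [:1, - r j:]) 1 = - (\<Sum>j\<in>J. r j)"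
    and "coeff (\<Prod>j\<in>J. [:1, - r j:]) 2 = ((\<Sum>j\<in>J. r j)\<^sup>2 - (\<Sum>j\<in>J. (r j)\<^sup>2)) / 2"
  using assms
proof (induction J)
  case (insert x J)
  { case 1 then show ?case using insert by simp }
  { case 2 then show ?case using insert by simp }
  { case 3 then show ?case using insert
      by (simp add: numeral_2_eq_2 power2_eq_square field_simps) }
qed (simp_all add: coeff_1)

text \<open>Reversal of coefficients is multiplicative and turns \<open>X - r j\<close> into
  \<open>1 - r j * X\<close>.\<close>

lemma coeff_prod_linear_reflect:
  fixes r :: "'b \<Rightarrow> real"
  assumes "finite J" "i \<le> card J"
  shows "coeff (\<Prod>j\<in>J. [:- r j, 1:]) (card J - i) = coeff (\<Prod>j\<in>J. [:1, - r j:]) i"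
proof -
  have "reflect_poly (\<Prod>j\<in>J. [:- r j, 1:]) = (\<Prod>j\<in>J. [:1, - r j:])"
    unfolding reflect_poly_prod by (intro prod.cong) (auto simp: reflect_poly_def)
  then show ?thesis
    using assms by (metis coeff_reflect_poly degree_prod_linear not_le)
qed

text \<open>Supplies the hypotheses of \<open>fps_central_limit\<close>. Mean zero removes the
  linear term, and the second elementary symmetric function \<open>- m v / 2\<close> gets the weight
  \<open>1 / (m (m - 1))\<close>. The bound depends only on \<open>m\<close> and \<open>v\<close>,
  hence is uniform over the sequence.\<close>

lemma conv_fps_prod_linear:
  fixes r :: "nat \<Rightarrow> real"
  assumes "m \<ge> 2" "(\<Sum>j=1..m. r j) = 0" "(1 / real m) * (\<Sum>j=1..m. (r j)\<^sup>2) = v"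
  defines "P \<equiv> (\<Prod>j=1..m. [:- r j, 1:])"
  shows "conv_fps m P $ 0 = 1" "conv_fps m P $ 1 = 0"
    and "conv_fps m P $ 2 = - v / (2 * (real m - 1))"
    and "\<bar>conv_fps m P $ k\<bar> \<le> (1 + sqrt (real m * v)) ^ m"
proof -
  have sq: "(\<Sum>j=1..m. (r j)\<^sup>2) = real m * v"
    using assms(1,3) by (auto simp: field_simps)
  have refl: "signed_coeff m P i = (-1) ^ i * coeff (\<Prod>j=1..m. [:1, - r j:]) i" if "i \<le> m" for i
    using coeff_prod_linear_reflect [of "{1..m}" i r] that by (simp add: signed_coeff_def P_def)
  note c = coeff_prod_reflected_linear [of "{1..m}" r, simplified assms(2) sq]
  show "conv_fps m P $ 0 = 1"
    using refl [of 0] c by (simp add: conv_fps_nth)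
  show "conv_fps m P $ 1 = 0"
    using refl [of 1] c assms(1) by (simp add: conv_fps_nth)
  obtain l where m: "m = Suc (Suc l)"
    using assms(1) by (metis add_2_eq_Suc le_Suc_ex)
  have "fact m = real m * (real m - 1) * fact (m - 2)"
    by (simp add: m algebra_simps)
  then have "fact (m - 2) / fact m = 1 / (real m * (real m - 1))"
    by simp
  then show "conv_fps m P $ 2 = - v / (2 * (real m - 1))"
    using refl [of 2] c assms(1) by (simp add: conv_fps_nth)
  have r: "\<bar>r j\<bar> \<le> sqrt (real m * v)" if "j \<in> {1..m}" for j
    using member_le_sum [of j "{1..m}" "\<lambda>j. (r j)\<^sup>2", unfolded sq] that
    by (intro real_le_rsqrt) auto
  have v: "v \<ge> 0" unfolding assms(3) [symmetric] by (simp add: sum_nonneg)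
  show "\<bar>conv_fps m P $ k\<bar> \<le> (1 + sqrt (real m * v)) ^ m"
  proof (cases "k \<le> m")
    case True
    have "\<bar>conv_fps m P $ k\<bar> = fact (m - k) / fact m * \<bar>coeff P (m - k)\<bar>"
      using True by (simp add: conv_fps_nth signed_coeff_def abs_mult)
    also have "\<dots> \<le> 1 * \<bar>coeff P (m - k)\<bar>"
      by (intro mult_right_mono) (auto simp: fact_mono)
    also have "\<dots> \<le> (\<Prod>j=1..m. 1 + \<bar>r j\<bar>)"
      unfolding P_def using abs_coeff_prod_linear_le by simp
    also have "\<dots> \<le> (\<Prod>j=1..m. 1 + sqrt (real m * v))"
      using r by (intro prod_mono) auto
    finally show ?thesis by simp
  qed (use v in \<open>simp add: conv_fps_nth\<close>)
qed

section \<open>Return from power series to polynomials\<close>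

theorem theorem6p7:
  fixes m :: nat and \<sigma> :: real
    and p :: "nat \<Rightarrow> real poly" and r :: "nat \<Rightarrow> nat \<Rightarrow> real"
  assumes "m \<ge> 2" and "\<sigma> > 0"
    and "\<And>i. i \<ge> 1 \<Longrightarrow> p i = (\<Prod>j=1..m. [:- r i j, 1:])"
    and "\<And>i. i \<ge> 1 \<Longrightarrow> (\<Sum>j=1..m. r i j) = 0"
    and "\<And>i. i \<ge> 1 \<Longrightarrow> (1 / real m) * (\<Sum>j=1..m. (r i j)\<^sup>2) = \<sigma>\<^sup>2"
  shows "\<forall>k. (\<lambda>n. coeff (iter_conv m (\<lambda>i. clt_rescale m n (p i)) n) k)
               \<longlonglongrightarrow> coeff (gaussian_poly m 0 (\<sigma>\<^sup>2)) k"
proof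
  fix k
  let ?q = "\<lambda>n. iter_conv m (\<lambda>i. clt_rescale m n (p i)) n"
  let ?G = "gaussian_poly m 0 (\<sigma>\<^sup>2)"
  show "(\<lambda>n. coeff (?q n) k) \<longlonglongrightarrow> coeff ?G k"
  proof (cases "k \<le> m")
    case True
    \<comment> \<open>Series indices count down from the top degree \<open>m\<close>.\<close>
    define l where "l = m - k"
    have l: "l \<le> m" "k = m - l" using True by (auto simp: l_def)
    define c where "c = - \<sigma>\<^sup>2 / (2 * (real m - 1))"
    have p: "conv_fps m (p i) $ 0 = 1" "conv_fps m (p i) $ 1 = 0" "conv_fps m (p i) $ 2 = c"
      "\<bar>conv_fps m (p i) $ j\<bar> \<le> (1 + sqrt (real m * \<sigma>\<^sup>2)) ^ m" if "i \<ge> 1" for i j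
      unfolding c_def assms(3) [OF that]
      by (rule conv_fps_prod_linear [OF assms(1) assms(4,5) [OF that]])+
    have "(\<lambda>n. (\<Prod>i=1..n. fps_dilate (1 / sqrt (real n)) (conv_fps m (p i))) $ l)
        \<longlonglongrightarrow> fps_gaussian c $ l"
      by (rule fps_central_limit [OF p])
    \<comment> \<open>The iterated convolution is meaningful only for \<open>n \<ge> 1\<close>, so
      the identity is claimed eventually.\<close>
    moreover have "\<forall>\<^sub>F n in sequentially.
        (\<Prod>i=1..n. fps_dilate (1 / sqrt (real n)) (conv_fps m (p i))) $ l = conv_fps m (?q n) $ l"
      by (rule eventually_sequentiallyI [of 1])
         (simp add: conv_fps_iter_conv conv_fps_clt_rescale l)
    ultimately have "(\<lambda>n. conv_fps m (?q n) $ l) \<longlonglongrightarrow> fps_gaussian c $ l"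
      by (rule Lim_transform_eventually)
    also have "fps_gaussian c $ l = conv_fps m ?G $ l"
      using conv_fps_gaussian_poly [of m "\<sigma>\<^sup>2" l] assms(1,2) l by (simp add: c_def)
    finally show ?thesis
      unfolding l(2) coeff_conv_conv_fps [OF l(1)] by (intro tendsto_intros)
  next
    case False
    \<comment> \<open>The fold starts with the first polynomial, so its degree has to be bounded;
      every later convolution has degree at most \<open>m\<close> by construction.\<close>
    have "degree (clt_rescale m n (p 1)) \<le> m" for n
      using degree_prod_linear [of "{1..m}" "r 1"]
      by (auto simp: clt_rescale_def assms(3)
          intro!: order_trans [OF degree_smult_le] order_trans [OF degree_pcompose_linear_le])
    then have "degree (?q n) < k" if "n \<ge> 1" for n
      using degree_iter_conv_le [of "\<lambda>i. clt_rescale m n (p i)" m n] that False by fastforce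
    then have "\<forall>\<^sub>F n in sequentially. coeff (?q n) k = 0"
      by (intro eventually_sequentiallyI [of 1]) (simp add: coeff_eq_0)
    moreover have "coeff ?G k = 0"
      using False degree_gaussian_poly_le [of m 0 "\<sigma>\<^sup>2"] by (intro coeff_eq_0) auto
    ultimately show ?thesis
      by (simp add: tendsto_eventually)
  qed
qed

end
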